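(* Let $A(x)=(A_n(x))_{n\ge 0}$ be a sequence of real polynomials. Then $A(x)\in\mathcal{A}$ (i.e. $A(x)$ is an Appell sequence) if and only if there exists a unique $\boldsymbol{a}=(a_n)_{n\ge0}\in\mathcal{G}$ such that $$A(x)=L_{\boldsymbol{a}}I(x).$$ Such $\boldsymbol{a}\in\mathcal{G}$ (called the sequence associated to $A(x)$) is given by the equivalent equations $$a_n=\sum_{k=0}^n s(n,k)A_k(0)\ \ (n\in\mathbb{N}_0)\quad\Longleftrightarrow\quad A_n(0)=\sum_{k=0}^n S(n,k)a_k\ \ (n\in\mathbb{N}_0).$$ As a consequence, for all $n\in\mathbb{N}_0$ and $x\in\mathbb{R}$, $$A_n(x)=\sum_{k=0}^n\frac{a_k}{k!}\Delta^kI_n(x)=\sum_{k=0}^n\binom{n}{k}a_k\,\mathbb{E}\big[(x+S_k)^{n-k}\big].$$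
   Context: $\mathbb{N}=\{1,2,\dots\}$, $\mathbb{N}_0=\mathbb{N}\cup\{0\}$. $\mathcal{G}$ is the set of real sequences $\boldsymbol{u}=(u_n)_{n\ge0}$ with $u_0\ne0$ and $\sum_{n\ge0}|u_n|r^n/n!<\infty$ for some $r>0$. An Appell sequence is a sequence of real polynomials $A(x)=(A_n(x))_{n\ge0}$ with $A(0)=(A_n(0))_{n\ge0}\in\mathcal{G}$ and $A_n(x)=\sum_{k=0}^n\binom{n}{k}A_k(0)x^{n-k}$ for all $n\in\mathbb{N}_0$; $\mathcal{A}$ is the set of all Appell sequences. $I(x)=(I_n(x))_{n\ge0}$ with $I_n(x)=x^n$. The $k$th forward difference is $\Delta^kf(x)=\sum_{j=0}^k\binom{k}{j}(-1)^{k-j}f(x+j)$. For $\boldsymbol{u}\in\mathcal{G}$ and $A(x)\in\mathcal{A}$, the forward difference transformation $L_{\boldsymbol{u}}A(x)=(L_{\boldsymbol{u}}A_n(x))_{n\ge0}$ is $L_{\boldsymbol{u}}A_n(x)=\sum_{k=0}^n\frac{u_k}{k!}\Delta^kA_n(x)$. $s(n,k)$ and $S(n,k)$, $0\le k\le n$, are the Stirling numbers of the first (signed) and second kind: $(x)_n=\sum_{k=0}^ns(n,k)x^k$ and $x^n=\sum_{k=0}^nS(n,k)(x)_k$, where $(x)_n=x(x-1)\cdots(x-n+1)$. $S_k=U_1+\cdots+U_k$ ($S_0=0$), where $(U_j)_{j\ge1}$ are independent random variables uniformly distributed on $[0,1]$, and $\mathbb{E}$ is expectation. *)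

theory Defs
  imports
    "HOL-Probability.Probability"
    "HOL-Combinatorics.Stirling"
    "HOL-Computational_Algebra.Polynomial"
begin

definition egf_seqs :: "(nat \<Rightarrow> real) set" where
  "egf_seqs = {u. u 0 \<noteq> 0 \<and> (\<exists>r>0. summable (\<lambda>n. \<bar>u n\<bar> * r ^ n / fact n))}"

definition appell_seqs :: "(nat \<Rightarrow> real poly) set" where
  "appell_seqs = {A. (\<lambda>n. poly (A n) 0) \<in> egf_seqs \<and>
     (\<forall>n x. poly (A n) x = (\<Sum>k\<le>n. real (n choose k) * poly (A k) 0 * x ^ (n - k)))}"

definition monom_seq :: "nat \<Rightarrow> real poly" where
  "monom_seq n = monom 1 n"

definition fdiff :: "nat \<Rightarrow> (real \<Rightarrow> real) \<Rightarrow> real \<Rightarrow> real" where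
  "fdiff k f x = (\<Sum>j\<le>k. real (k choose j) * (-1) ^ (k - j) * f (x + real j))"

definition fdiff_transform ::
    "(nat \<Rightarrow> real) \<Rightarrow> (nat \<Rightarrow> real poly) \<Rightarrow> nat \<Rightarrow> real \<Rightarrow> real" where
  "fdiff_transform u A n x = (\<Sum>k\<le>n. u k / fact k * fdiff k (poly (A n)) x)"

definition falling :: "real \<Rightarrow> nat \<Rightarrow> real" where
  "falling x n = (\<Prod>i<n. x - real i)"

text \<open>The library's \<^const>\<open>stirling\<close> is the unsigned number of the first kind,
  while \<^const>\<open>Stirling\<close> is the number of the second kind.  The lemmas below
  confirm the expansions by which the (signed) numbers are usually defined.\<close>

definition signed_stirling :: "nat \<Rightarrow> nat \<Rightarrow> real" where
  "signed_stirling n k = (-1) ^ (n - k) * real (stirling n k)"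

lemma falling_conv_signed_stirling:
  "falling x n = (\<Sum>k\<le>n. signed_stirling n k * x ^ k)"
proof -
  have "falling x n = (-1) ^ n * pochhammer (- x) n"
    by (induction n) (auto simp: falling_def pochhammer_Suc algebra_simps)
  also have "\<dots> = (\<Sum>k\<le>n. (-1) ^ n * (real (stirling n k) * (- x) ^ k))"
    by (simp add: stirling_pochhammer [symmetric] sum_distrib_left)
  also have "\<dots> = (\<Sum>k\<le>n. signed_stirling n k * x ^ k)"
  proof (rule sum.cong[OF refl])
    fix k assume "k \<in> {..n}"
    then obtain m where "n = k + m" by (auto simp: le_iff_add)
    have "(-1) ^ n * (- x) ^ k = ((-1) ^ m * ((-1) ^ k * (-1) ^ k)) * x ^ k"
      unfolding \<open>n = k + m\<close> power_add power_minus[of x] by (simp only: mult_ac)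
    also have "\<dots> = (-1) ^ (n - k) * x ^ k"
      using \<open>n = k + m\<close> by (simp flip: power_add mult_2)
    finally show "(-1) ^ n * (real (stirling n k) * (- x) ^ k) = signed_stirling n k * x ^ k"
      by (simp add: signed_stirling_def mult.left_commute mult.commute)
  qed
  finally show ?thesis .
qed

lemma power_conv_Stirling:
  "x ^ n = (\<Sum>k\<le>n. real (Stirling n k) * falling x k)"
proof (induction n)
  case 0
  then show ?case by (simp add: falling_def)
next
  case (Suc n)
  have *: "x * falling x k = falling x (Suc k) + real k * falling x k" for k
    by (simp add: falling_def algebra_simps)
  have "x ^ Suc n = (\<Sum>k\<le>n. real (Stirling n k) * (x * falling x k))"
    by (simp add: Suc.IH sum_distrib_left mult_ac)
  also have "\<dots> = (\<Sum>k\<le>n. real (Stirling n k) * falling x (Suc k))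
      + (\<Sum>k\<le>n. real k * real (Stirling n k) * falling x k)"
    by (simp add: * algebra_simps sum.distrib)
  also have "(\<Sum>k\<le>n. real k * real (Stirling n k) * falling x k)
      = (\<Sum>k\<le>Suc n. real k * real (Stirling n k) * falling x k)"
    by simp
  also have "\<dots> = (\<Sum>k\<le>n. real (Suc k) * real (Stirling n (Suc k)) * falling x (Suc k))"
    by (subst sum.atMost_Suc_shift) simp
  finally show ?case
    by (subst sum.atMost_Suc_shift) (simp add: sum.distrib algebra_simps)
qed

text \<open>The variables are indexed from 1; \<open>U 0\<close> is irrelevant.\<close>

definition iid_uniform :: "'a measure \<Rightarrow> (nat \<Rightarrow> 'a \<Rightarrow> real) \<Rightarrow> bool" where
  "iid_uniform M U \<longleftrightarrow> prob_space M \<and>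
     prob_space.indep_vars M (\<lambda>_. borel) U {1..} \<and>
     (\<forall>j\<ge>1. distr M borel (U j) = uniform_measure lborel {0..1})"

lemma iid_uniform_exists:
  "\<exists>U. iid_uniform (Pi\<^sub>M UNIV (\<lambda>_::nat. uniform_measure lborel {0..1::real})) U"
proof -
  let ?N = "uniform_measure lborel {0..1::real}"
  let ?M = "Pi\<^sub>M UNIV (\<lambda>_::nat. ?N)"
  have N: "prob_space ?N"
    by (rule prob_space_uniform_measure) auto
  interpret product_prob_space "\<lambda>_. ?N" "UNIV :: nat set"
    by (rule product_prob_spaceI) (rule N)
  have M: "prob_space ?M" by (rule prob_space_PiM) (rule N)
  have S: "sets ?N = sets borel" by simp
  have meas: "(\<lambda>\<omega>. \<omega> j) \<in> measurable ?M borel" for j :: nat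
    using measurable_component_singleton[of j UNIV "\<lambda>_. ?N"]
    by (simp cong: measurable_cong_sets)
  have D: "distr ?M borel (\<lambda>\<omega>. \<omega> j) = ?N" for j :: nat
    using PiM_component[of j] distr_cong[of ?M ?M borel ?N "\<lambda>\<omega>. \<omega> j" "\<lambda>\<omega>. \<omega> j"] by simp
  have "prob_space.indep_vars ?M (\<lambda>_. borel) (\<lambda>j \<omega>. \<omega> j) {1::nat..}"
  proof (subst prob_space.indep_vars_iff_distr_eq_PiM[OF M _ meas])
    show "{1::nat..} \<noteq> {}" by simp
    have "distr ?M (\<Pi>\<^sub>M i\<in>{1..}. borel) (\<lambda>x. \<lambda>i\<in>{1..}. x i)
        = distr ?M (Pi\<^sub>M {1..} (\<lambda>_. ?N)) (\<lambda>x. restrict x {1..})"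
      by (intro distr_cong sets_PiM_cong) auto
    also have "\<dots> = Pi\<^sub>M {1..} (\<lambda>_. ?N)"
      using distr_PiM_reindex[of UNIV "\<lambda>_. ?N" "\<lambda>i. i" "{1::nat..}"] N by simp
    also have "\<dots> = Pi\<^sub>M {1..} (\<lambda>i. distr ?M borel (\<lambda>\<omega>. \<omega> i))"
      by (simp add: D)
    finally show "distr ?M (\<Pi>\<^sub>M i\<in>{1..}. borel) (\<lambda>x. \<lambda>i\<in>{1..}. x i)
      = Pi\<^sub>M {1..} (\<lambda>i. distr ?M borel (\<lambda>\<omega>. \<omega> i))" .
  qed
  with M D show ?thesis unfolding iid_uniform_def by blast
qed

definition partial_sum :: "(nat \<Rightarrow> 'a \<Rightarrow> real) \<Rightarrow> nat \<Rightarrow> 'a \<Rightarrow> real" where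
  "partial_sum U k \<omega> = (\<Sum>j\<in>{1..k}. U j \<omega>)"

end

theory Submission
  imports Defs
begin

text \<open>
  Expanding $(x+y)^n$ around $x$ gives
  $\Delta^k I_n(x) = \sum_i \binom{n}{i} x^{n-i} \Delta^k I_i(0)$, and
  $\Delta^k I_i(0) = k!\,S(i,k)$ because the product rule for $\Delta^k(y \cdot y^i)$ at $0$
  is the recurrence of the Stirling numbers of the second kind. Weighting with $a_k/k!$ and
  summing over $k$ therefore produces the Appell polynomial
  $\sum_i \binom{n}{i} b_i x^{n-i}$ with constant terms $b_i = \sum_k S(i,k) a_k$.
  So $A = L_a I$ says precisely two things: $A$ satisfies the Appell identity, and $A(0)$ is the
  Stirling transform of $a$ (lemma \<open>eq_fdiff_transform_monom_seq_iff\<close>). The rest is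
  the following three facts about these objects.

  The Stirling transform of sequences is a bijection whose inverse is given by the signed Stirling
  numbers of the first kind: substituting the two defining expansions into each other shows that
  one composite is the identity, and a triangular transform with unit diagonal is injective, which
  makes the other composite the identity too.

  Both transforms preserve the set of admissible sequences. Membership amounts to a bound
  $|u_n| \le C M^n n!$, and for both kinds of Stirling numbers
  $k!\,T(n,k) \le n! \binom{n}{k}$, so that the binomial theorem turns the bound for $u$ into
  the bound $C (M+1)^n n!$ for the transform of $u$.

  The probabilistic formula is $\Delta^k I_n(x) = k! \binom{n}{k} E[(x+S_k)^{n-k}]$, a case of
  $\Delta^k f(x) = E[f^{(k)}(x+S_k)]$. One step of it is the identity
  $(m+1)\,E[(y+U)^m] = (y+1)^{m+1} - y^{m+1}$, averaged over $y = x + S_k$ by independence.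
\<close>

section \<open>Forward differences of powers\<close>

lemma fdiff_0 [simp]: "fdiff 0 f x = f x"
  by (simp add: fdiff_def)

text \<open>Pascal's rule turns the alternating sum into a recursion, so that the rules below go by
  induction on the order of the difference.\<close>

lemma fdiff_Suc: "fdiff (Suc k) f x = fdiff k f (x + 1) - fdiff k f x"
proof -
  define g where "g j = (-1) ^ (k - j) * f (x + real j)" for j
  have shifted: "fdiff k f (x + 1) = (\<Sum>j\<le>k. real (k choose j) * ((-1) ^ (k - j) * f (x + real (Suc j))))"
    by (simp add: fdiff_def algebra_simps)
  have sign: "real (k choose Suc j) * ((-1) ^ (k - j) * f (x + real (Suc j)))
      = - (real (k choose Suc j) * g (Suc j))" if "j \<le> k" for j
  proof (cases "j = k")
    case False
    with that have "k - j = Suc (k - Suc j)" by simp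
    then show ?thesis by (simp add: g_def)
  qed (simp add: binomial_eq_0)
  have "fdiff (Suc k) f x = (-1) ^ Suc k * f x
      + (\<Sum>j\<le>k. real (Suc k choose Suc j) * ((-1) ^ (k - j) * f (x + real (Suc j))))"
    unfolding fdiff_def by (subst sum.atMost_Suc_shift) (simp add: mult.assoc)
  also have "(\<Sum>j\<le>k. real (Suc k choose Suc j) * ((-1) ^ (k - j) * f (x + real (Suc j))))
      = fdiff k f (x + 1) + (\<Sum>j\<le>k. real (k choose Suc j) * ((-1) ^ (k - j) * f (x + real (Suc j))))"
    unfolding shifted by (simp add: distrib_right sum.distrib)
  also have "(\<Sum>j\<le>k. real (k choose Suc j) * ((-1) ^ (k - j) * f (x + real (Suc j))))
      = - (\<Sum>j\<le>k. real (k choose Suc j) * g (Suc j))"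
    unfolding sum_negf [symmetric] by (intro sum.cong refl sign) simp
  also have "(\<Sum>j\<le>k. real (k choose Suc j) * g (Suc j)) = (\<Sum>j\<le>Suc k. real (k choose j) * g j) - g 0"
    by (subst sum.atMost_Suc_shift) simp
  also have "(\<Sum>j\<le>Suc k. real (k choose j) * g j) = fdiff k f x"
    by (simp add: fdiff_def g_def mult.assoc)
  finally show ?thesis by (simp add: g_def)
qed

lemma fdiff_Suc_const: "fdiff (Suc k) (\<lambda>_. c) x = 0"
proof (induction k arbitrary: x)
  case (Suc k)
  show ?case unfolding fdiff_Suc [of "Suc k"] Suc.IH by simp
qed (simp add: fdiff_Suc)

lemma fdiff_sum: "fdiff k (\<lambda>y. \<Sum>i\<in>I. f i y) x = (\<Sum>i\<in>I. fdiff k (f i) x)"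
  by (induction k arbitrary: x) (simp_all add: fdiff_Suc sum_subtractf)

lemma fdiff_cmult: "fdiff k (\<lambda>y. c * f y) x = c * fdiff k f x"
  by (induction k arbitrary: x) (simp_all add: fdiff_Suc algebra_simps)

lemma fdiff_translate: "fdiff k (\<lambda>y. f (x + y)) z = fdiff k f (x + z)"
  by (simp add: fdiff_def add.assoc)

text \<open>This is the Leibniz rule for $\Delta^{k+1}$, which stops after two terms because
  the second difference of the identity vanishes.\<close>

lemma fdiff_times_ident:
  "fdiff (Suc k) (\<lambda>y. y * f y) x = x * fdiff (Suc k) f x + real (Suc k) * fdiff k f (x + 1)"
proof (induction k arbitrary: x)
  case 0
  show ?case by (simp add: fdiff_Suc algebra_simps)
next
  case (Suc k)
  have rec: "fdiff (Suc k) f (x + 1) = fdiff k f (x + 1 + 1) - fdiff k f (x + 1)"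
    by (rule fdiff_Suc)
  show ?case
    unfolding fdiff_Suc [of "Suc k"] Suc.IH rec by (simp add: fdiff_Suc algebra_simps)
qed

text \<open>At $0$ the Leibniz rule loses its first term, and what remains is the recurrence of
  the Stirling numbers of the second kind, scaled by $k!$.\<close>

lemma fdiff_power_at_0: "fdiff k (\<lambda>y. y ^ i) 0 = fact k * real (Stirling i k)"
proof (induction i arbitrary: k)
  case 0
  show ?case by (cases k) (simp_all add: fdiff_Suc_const)
next
  case (Suc i)
  show ?case
  proof (cases k)
    case 0
    then show ?thesis by simp
  next
    case (Suc l)
    have "fdiff (Suc l) (\<lambda>y. y ^ Suc i) 0 = real (Suc l) * fdiff l (\<lambda>y. y ^ i) 1"
      using fdiff_times_ident [of l "\<lambda>y. y ^ i" 0] by simp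
    also have "fdiff l (\<lambda>y. y ^ i) 1 = fdiff (Suc l) (\<lambda>y. y ^ i) 0 + fdiff l (\<lambda>y. y ^ i) 0"
      by (simp add: fdiff_Suc)
    finally show ?thesis
      unfolding Suc.IH using Suc by (simp add: algebra_simps)
  qed
qed

lemma fdiff_power:
  "fdiff k (\<lambda>y. y ^ n) x
    = (\<Sum>i\<le>n. real (n choose i) * (fact k * real (Stirling i k)) * x ^ (n - i))"
proof -
  have "fdiff k (\<lambda>y. y ^ n) x = fdiff k (\<lambda>y. (x + y) ^ n) 0"
    using fdiff_translate [of k "\<lambda>y. y ^ n" x 0] by simp
  also have "(\<lambda>y. (x + y) ^ n) = (\<lambda>y. \<Sum>i\<le>n. (real (n choose i) * x ^ (n - i)) * y ^ i)"
    by (simp add: binomial_ring [of _ x] add.commute [of x] mult_ac)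
  finally have "fdiff k (\<lambda>y. y ^ n) x
      = (\<Sum>i\<le>n. (real (n choose i) * x ^ (n - i)) * (fact k * real (Stirling i k)))"
    by (simp only: fdiff_sum fdiff_cmult fdiff_power_at_0)
  then show ?thesis by (simp only: mult_ac)
qed

section \<open>Stirling transforms\<close>

definition Stirling_transform :: "(nat \<Rightarrow> real) \<Rightarrow> nat \<Rightarrow> real" where
  "Stirling_transform a n = (\<Sum>k\<le>n. real (Stirling n k) * a k)"

definition signed_stirling_transform :: "(nat \<Rightarrow> real) \<Rightarrow> nat \<Rightarrow> real" where
  "signed_stirling_transform b n = (\<Sum>k\<le>n. signed_stirling n k * b k)"

lemma sum_lower_triangle_swap:
  fixes f :: "nat \<Rightarrow> nat \<Rightarrow> 'b :: comm_monoid_add"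
  assumes "\<And>k j. k < j \<Longrightarrow> f k j = 0"
  shows "(\<Sum>k\<le>n. \<Sum>j\<le>k. f k j) = (\<Sum>j\<le>n. \<Sum>k\<le>n. f k j)"
proof -
  have "(\<Sum>k\<le>n. \<Sum>j\<le>k. f k j) = (\<Sum>k\<le>n. \<Sum>j\<le>n. f k j)"
    by (intro sum.cong refl sum.mono_neutral_left) (auto simp: assms)
  also have "\<dots> = (\<Sum>j\<le>n. \<Sum>k\<le>n. f k j)"
    by (rule sum.swap)
  finally show ?thesis .
qed

text \<open>Insert the expansion of the falling factorials into that of $x^n$ and compare
  coefficients of powers of $x$.\<close>

lemma Stirling_orthogonality:
  assumes "m \<le> n"
  shows "(\<Sum>k\<le>n. real (Stirling n k) * signed_stirling k m) = (if m = n then 1 else 0)"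
proof -
  define c where "c m = (\<Sum>k\<le>n. real (Stirling n k) * signed_stirling k m)" for m
  have "x ^ n = (\<Sum>m\<le>n. c m * x ^ m)" for x
  proof -
    have "x ^ n = (\<Sum>k\<le>n. \<Sum>m\<le>k. real (Stirling n k) * signed_stirling k m * x ^ m)"
      by (subst power_conv_Stirling)
         (simp add: falling_conv_signed_stirling sum_distrib_left mult.assoc)
    also have "\<dots> = (\<Sum>m\<le>n. c m * x ^ m)"
      by (subst sum_lower_triangle_swap)
         (simp_all add: c_def signed_stirling_def sum_distrib_right)
    finally show ?thesis .
  qed
  then have "\<forall>x. (\<Sum>m\<le>n. (c m - (if m = n then 1 else 0)) * x ^ m) = 0"
    by (simp add: left_diff_distrib sum_subtractf if_distrib [of "\<lambda>t. t * _"] cong: if_cong)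
  then have "\<forall>m\<le>n. c m - (if m = n then 1 else 0) = 0"
    by (simp only: polyfun_eq_0)
  with assms show ?thesis
    by (simp add: c_def)
qed

lemma Stirling_transform_signed_stirling_transform:
  "Stirling_transform (signed_stirling_transform b) = b"
proof
  fix n
  have "Stirling_transform (signed_stirling_transform b) n
      = (\<Sum>k\<le>n. \<Sum>m\<le>k. real (Stirling n k) * signed_stirling k m * b m)"
    by (simp add: Stirling_transform_def signed_stirling_transform_def sum_distrib_left mult.assoc)
  also have "\<dots> = (\<Sum>m\<le>n. (\<Sum>k\<le>n. real (Stirling n k) * signed_stirling k m) * b m)"
    by (subst sum_lower_triangle_swap) (simp_all add: signed_stirling_def sum_distrib_right)
  also have "\<dots> = (\<Sum>m\<le>n. (if m = n then 1 else 0) * b m)"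
    by (intro sum.cong refl) (simp add: Stirling_orthogonality)
  also have "\<dots> = b n"
    by (simp add: if_distrib [of "\<lambda>t. t * _"] cong: if_cong)
  finally show "Stirling_transform (signed_stirling_transform b) n = b n" .
qed

lemma Stirling_transform_inject:
  assumes "Stirling_transform a = Stirling_transform a'"
  shows "a = a'"
proof
  fix n
  show "a n = a' n"
  proof (induction n rule: less_induct)
    case (less n)
    have split: "Stirling_transform c n = (\<Sum>k<n. real (Stirling n k) * c k) + c n" for c
      by (simp add: Stirling_transform_def flip: lessThan_Suc_atMost)
    have "(\<Sum>k<n. real (Stirling n k) * a k) = (\<Sum>k<n. real (Stirling n k) * a' k)"
      by (intro sum.cong refl) (simp add: less.IH)
    moreover have "Stirling_transform a n = Stirling_transform a' n"
      by (simp only: assms)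
    ultimately show ?case by (simp only: split add_left_cancel)
  qed
qed

text \<open>The orthogonality relation makes the signed transform a right inverse of the
  Stirling transform; injectivity of the latter promotes it to a two-sided one.\<close>

lemma signed_stirling_transform_eq_iff:
  "a = signed_stirling_transform b \<longleftrightarrow> b = Stirling_transform a"
proof
  assume "b = Stirling_transform a"
  then have "Stirling_transform a = Stirling_transform (signed_stirling_transform b)"
    by (simp only: Stirling_transform_signed_stirling_transform)
  then show "a = signed_stirling_transform b" by (rule Stirling_transform_inject)
qed (simp only: Stirling_transform_signed_stirling_transform)

section \<open>Exponential generating functions with positive radius of convergence\<close>

text \<open>The terms of a convergent series are bounded, which gives $M = 1/r$; conversely, below
  half the guaranteed radius the series is dominated by a geometric one. The bound, unlike the
  series, is easily transported through finite sums.\<close>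

lemma egf_seqs_iff_bound:
  "u \<in> egf_seqs \<longleftrightarrow> u 0 \<noteq> 0 \<and> (\<exists>C M. 0 \<le> C \<and> 0 \<le> M \<and> (\<forall>n. \<bar>u n\<bar> \<le> C * M ^ n * fact n))"
proof -
  have bound_if: "\<exists>C M. 0 \<le> C \<and> 0 \<le> M \<and> (\<forall>n. \<bar>u n\<bar> \<le> C * M ^ n * fact n)"
    if "r > 0" and summ: "summable (\<lambda>n. \<bar>u n\<bar> * r ^ n / fact n)" for r
  proof (intro exI conjI allI)
    let ?C = "\<Sum>n. \<bar>u n\<bar> * r ^ n / fact n"
    show "0 \<le> ?C"
      using \<open>r > 0\<close> by (intro suminf_nonneg summ) simp
    show "0 \<le> 1 / r" using \<open>r > 0\<close> by simp
    fix n
    have "\<bar>u n\<bar> * r ^ n / fact n = (\<Sum>i\<in>{n}. \<bar>u i\<bar> * r ^ i / fact i)" by simp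
    also have "\<dots> \<le> ?C"
      using \<open>r > 0\<close> by (intro sum_le_suminf summ) auto
    finally show "\<bar>u n\<bar> \<le> ?C * (1 / r) ^ n * fact n"
      using \<open>r > 0\<close> by (simp add: field_simps)
  qed
  have summable_if: "\<exists>r>0. summable (\<lambda>n. \<bar>u n\<bar> * r ^ n / fact n)"
    if "0 \<le> C" "0 \<le> M" and bound: "\<And>n. \<bar>u n\<bar> \<le> C * M ^ n * fact n" for C M
  proof (intro exI conjI)
    \<comment> \<open>\<open>M + 1\<close> in place of \<open>M\<close> keeps the radius positive when \<open>M = 0\<close>, as \<open>1 / 0 = 0\<close>.\<close>
    let ?r = "1 / (2 * (M + 1))"
    show "?r > 0" using that by simp
    have ratio: "M * ?r \<le> 1 / 2" using that by (simp add: field_simps)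
    have "summable (\<lambda>n. C * (1 / 2) ^ n)"
      by (intro summable_mult summable_geometric) simp
    then show "summable (\<lambda>n. \<bar>u n\<bar> * ?r ^ n / fact n)"
    proof (rule summable_comparison_test')
      fix n :: nat
      have "\<bar>u n\<bar> * ?r ^ n / fact n \<le> C * M ^ n * fact n * ?r ^ n / fact n"
        using that by (intro divide_right_mono mult_right_mono bound) auto
      also have "\<dots> = C * (M * ?r) ^ n"
        by (simp add: power_mult_distrib power_divide)
      also have "\<dots> \<le> C * (1 / 2) ^ n"
        using that ratio by (intro mult_left_mono power_mono) auto
      finally show "norm (\<bar>u n\<bar> * ?r ^ n / fact n) \<le> C * (1 / 2) ^ n"
        using that by simp
    qed
  qed
  show ?thesis
    unfolding egf_seqs_def mem_Collect_eq
  proof (intro conj_cong refl iffI)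
    assume "\<exists>r>0. summable (\<lambda>n. \<bar>u n\<bar> * r ^ n / fact n)"
    then show "\<exists>C M. 0 \<le> C \<and> 0 \<le> M \<and> (\<forall>n. \<bar>u n\<bar> \<le> C * M ^ n * fact n)"
      by (elim exE conjE) (rule bound_if)
  next
    assume "\<exists>C M. 0 \<le> C \<and> 0 \<le> M \<and> (\<forall>n. \<bar>u n\<bar> \<le> C * M ^ n * fact n)"
    then obtain C M where "0 \<le> C" "0 \<le> M" "\<forall>n. \<bar>u n\<bar> \<le> C * M ^ n * fact n"
      by blast
    then show "\<exists>r>0. summable (\<lambda>n. \<bar>u n\<bar> * r ^ n / fact n)"
      using summable_if [of C M] by simp
  qed
qed

text \<open>A common majorant for both kinds of Stirling numbers: the coefficient of
  $T(n,k+1)$ in the recurrence is $k+1$ for the second kind and $n$ for the first. After scaling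
  by $(k+1)!$ both coefficients are at most $n+1$ as long as $k \le n$, so the induction step
  becomes Pascal's rule multiplied by $(n+1)!$.\<close>

lemma triangular_array_bound:
  fixes T :: "nat \<Rightarrow> nat \<Rightarrow> nat"
  assumes "T 0 0 \<le> 1" and "\<And>k. T 0 (Suc k) = 0" and "\<And>n. T (Suc n) 0 = 0"
    and "\<And>n k. n < k \<Longrightarrow> T n k = 0"
    and step: "\<And>n k. k \<le> n \<Longrightarrow> T (Suc n) (Suc k) \<le> Suc n * T n (Suc k) + T n k"
  shows "fact k * T n k \<le> fact n * (n choose k)"
proof (induction n arbitrary: k)
  case 0
  show ?case using assms(1,2) by (cases k) simp_all
next
  case (Suc n)
  show ?case
  proof (cases k)
    case 0
    then show ?thesis by (simp add: assms(3))
  next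
    case (Suc l)
    show ?thesis
    proof (cases "l \<le> n")
      case False
      with Suc show ?thesis by (simp add: assms(4))
    next
      case True
      have "fact (Suc l) * T (Suc n) (Suc l) \<le> fact (Suc l) * (Suc n * T n (Suc l) + T n l)"
        by (intro mult_le_mono2 step True)
      also have "\<dots> = Suc n * (fact (Suc l) * T n (Suc l)) + Suc l * (fact l * T n l)"
        by (simp add: algebra_simps)
      also have "\<dots> \<le> Suc n * (fact n * (n choose Suc l)) + Suc n * (fact n * (n choose l))"
        using True by (intro add_mono mult_mono Suc.IH) auto
      also have "\<dots> = fact (Suc n) * (Suc n choose Suc l)"
        by (simp add: algebra_simps)
      finally show ?thesis using Suc by simp
    qed
  qed
qed

lemma fact_Stirling_le: "fact k * Stirling n k \<le> fact n * (n choose k)"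
  by (rule triangular_array_bound) auto

lemma fact_stirling_le: "fact k * stirling n k \<le> fact n * (n choose k)"
  by (rule triangular_array_bound) auto

lemma triangular_transform_mem_egf_seqs:
  fixes T :: "nat \<Rightarrow> nat \<Rightarrow> real"
  assumes u: "u \<in> egf_seqs" and T00: "T 0 0 \<noteq> 0"
    and T: "\<And>n k. \<bar>T n k\<bar> * fact k \<le> fact n * real (n choose k)"
  shows "(\<lambda>n. \<Sum>k\<le>n. T n k * u k) \<in> egf_seqs"
proof -
  obtain C M where u0: "u 0 \<noteq> 0" and C: "0 \<le> C" and M: "0 \<le> M"
    and bound: "\<And>n. \<bar>u n\<bar> \<le> C * M ^ n * fact n"
    using u unfolding egf_seqs_iff_bound by blast
  have "\<bar>\<Sum>k\<le>n. T n k * u k\<bar> \<le> C * (M + 1) ^ n * fact n" for n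
  proof -
    have "\<bar>\<Sum>k\<le>n. T n k * u k\<bar> \<le> (\<Sum>k\<le>n. \<bar>T n k\<bar> * \<bar>u k\<bar>)"
      by (rule order_trans [OF sum_abs]) (simp add: abs_mult)
    also have "\<dots> \<le> (\<Sum>k\<le>n. \<bar>T n k\<bar> * (C * M ^ k * fact k))"
      by (intro sum_mono mult_left_mono bound) simp
    also have "\<dots> = (\<Sum>k\<le>n. C * M ^ k * (\<bar>T n k\<bar> * fact k))"
      by (simp add: mult_ac)
    also have "\<dots> \<le> (\<Sum>k\<le>n. C * M ^ k * (fact n * real (n choose k)))"
      using C M by (intro sum_mono mult_left_mono T) simp
    also have "\<dots> = C * (M + 1) ^ n * fact n"
      by (simp add: binomial_ring sum_distrib_left sum_distrib_right mult_ac)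
    finally show ?thesis .
  qed
  then have "\<exists>C M. 0 \<le> C \<and> 0 \<le> M \<and> (\<forall>n. \<bar>\<Sum>k\<le>n. T n k * u k\<bar> \<le> C * M ^ n * fact n)"
    using C M by (intro exI [of _ C] exI [of _ "M + 1"]) simp
  then show ?thesis
    using u0 T00 by (simp add: egf_seqs_iff_bound)
qed

lemma Stirling_transform_mem_egf_seqs: "a \<in> egf_seqs \<Longrightarrow> Stirling_transform a \<in> egf_seqs"
  unfolding Stirling_transform_def
proof (erule triangular_transform_mem_egf_seqs)
  show "\<bar>real (Stirling n k)\<bar> * fact k \<le> fact n * real (n choose k)" for n k
    using of_nat_mono [OF fact_Stirling_le [of k n], where ?'a = real] by (simp add: mult.commute)
qed simp

lemma signed_stirling_transform_mem_egf_seqs: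
  "b \<in> egf_seqs \<Longrightarrow> signed_stirling_transform b \<in> egf_seqs"
  unfolding signed_stirling_transform_def
proof (erule triangular_transform_mem_egf_seqs)
  show "\<bar>signed_stirling n k\<bar> * fact k \<le> fact n * real (n choose k)" for n k
    using of_nat_mono [OF fact_stirling_le [of k n], where ?'a = real]
    by (simp add: signed_stirling_def abs_mult power_abs mult.commute)
qed (simp add: signed_stirling_def)

section \<open>The forward difference transform of the monomials\<close>

lemma poly_monom_seq: "poly (monom_seq n) = (\<lambda>y. y ^ n)"
  by (simp add: fun_eq_iff monom_seq_def poly_monom)

text \<open>The sum over $k$ may stop at $i$ because $\Delta^k$ annihilates powers below $k$. Hence
  the coefficient of $\binom{n}{i} x^{n-i}$ does not depend on $n$, which is what makes
  the transform an Appell sequence.\<close>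

lemma fdiff_transform_monom_seq:
  "fdiff_transform a monom_seq n x
    = (\<Sum>i\<le>n. real (n choose i) * Stirling_transform a i * x ^ (n - i))"
proof -
  have "fdiff_transform a monom_seq n x
      = (\<Sum>k\<le>n. \<Sum>i\<le>n. real (n choose i) * (real (Stirling i k) * a k) * x ^ (n - i))"
    by (simp add: fdiff_transform_def poly_monom_seq fdiff_power sum_distrib_left mult_ac)
  also have "\<dots> = (\<Sum>i\<le>n. \<Sum>k\<le>i. real (n choose i) * (real (Stirling i k) * a k) * x ^ (n - i))"
    by (subst sum_lower_triangle_swap) simp_all
  finally show ?thesis
    by (simp add: Stirling_transform_def sum_distrib_left sum_distrib_right mult.assoc)
qed

lemma eq_fdiff_transform_monom_seq_iff:
  "(\<lambda>n. poly (A n)) = fdiff_transform a monom_seq \<longleftrightarrow>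
    (\<lambda>n. poly (A n) 0) = Stirling_transform a \<and>
    (\<forall>n x. poly (A n) x = (\<Sum>k\<le>n. real (n choose k) * poly (A k) 0 * x ^ (n - k)))"
    (is "?L \<longleftrightarrow> ?R")
proof
  assume ?L
  then have A: "poly (A n) x = (\<Sum>k\<le>n. real (n choose k) * Stirling_transform a k * x ^ (n - k))" for n x
    by (simp add: fun_eq_iff fdiff_transform_monom_seq)
  have A0: "poly (A n) 0 = Stirling_transform a n" for n
  proof -
    have "poly (A n) 0 = (\<Sum>k\<le>n. if k = n then Stirling_transform a k else 0)"
      unfolding A by (intro sum.cong) (auto simp: power_0_left)
    then show ?thesis by simp
  qed
  show ?R
  proof (intro conjI allI)
    show "(\<lambda>n. poly (A n) 0) = Stirling_transform a"
      by (simp only: A0)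
    show "poly (A n) x = (\<Sum>k\<le>n. real (n choose k) * poly (A k) 0 * x ^ (n - k))" for n x
      unfolding A0 by (rule A)
  qed
next
  assume ?R
  then have "(\<lambda>n. poly (A n) 0) = Stirling_transform a" ..
  then have A0: "poly (A n) 0 = Stirling_transform a n" for n
    by (simp only: fun_eq_iff)
  show ?L
  proof (intro ext)
    fix n x
    have "poly (A n) x = (\<Sum>k\<le>n. real (n choose k) * poly (A k) 0 * x ^ (n - k))"
      using \<open>?R\<close> by blast
    then show "poly (A n) x = fdiff_transform a monom_seq n x"
      by (simp only: A0 fdiff_transform_monom_seq)
  qed
qed

section \<open>Moments of sums of uniform random variables\<close>

lemma integral_uniform_power:
  "(\<integral>x. x ^ m \<partial>uniform_measure lborel {0..1::real}) = 1 / real (Suc m)"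
proof -
  have "uniform_measure lborel {0..1::real} = density lborel (\<lambda>x. ennreal (indicator {0..1} x))"
    unfolding uniform_measure_def by (intro density_cong) (auto simp: ennreal_indicator divide_ennreal_def)
  then have "(\<integral>x. x ^ m \<partial>uniform_measure lborel {0..1::real}) = (\<integral>x. x ^ m * indicator {0..1} x \<partial>lborel)"
    by (simp add: integral_real_density mult.commute)
  then show ?thesis by (simp add: integral_power)
qed

context
  fixes M :: "'a measure" and U :: "nat \<Rightarrow> 'a \<Rightarrow> real"
  assumes iid: "iid_uniform M U"
begin

interpretation prob_space M
  using iid by (simp add: iid_uniform_def)

lemma uniform_measurable: "j \<ge> 1 \<Longrightarrow> U j \<in> borel_measurable M"
  using iid by (auto simp: iid_uniform_def indep_vars_def2)

lemma partial_sum_measurable: "partial_sum U k \<in> borel_measurable M"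
  unfolding partial_sum_def by (intro borel_measurable_sum uniform_measurable) simp

lemma AE_uniform:
  assumes "j \<ge> 1"
  shows "AE \<omega> in M. U j \<omega> \<in> {0..1}"
proof -
  have "distr M borel (U j) = uniform_measure lborel {0..1}"
    using iid assms by (simp add: iid_uniform_def)
  then have "AE y in distr M borel (U j). y \<in> {0..1::real}"
    by (simp only:) (rule AE_uniform_measureI; simp)
  then show ?thesis
    using uniform_measurable [OF assms] by (subst (asm) AE_distr_iff) auto
qed

text \<open>Almost sure boundedness is what makes all the moments below integrable.\<close>

lemma AE_partial_sum: "AE \<omega> in M. \<bar>partial_sum U k \<omega>\<bar> \<le> real k"
proof -
  have "AE \<omega> in M. \<forall>j\<in>{1..k}. U j \<omega> \<in> {0..1}"
    by (rule AE_finite_allI) (auto intro!: AE_uniform [simplified])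
  then show ?thesis
  proof eventually_elim
    case (elim \<omega>)
    have "\<bar>partial_sum U k \<omega>\<bar> \<le> (\<Sum>j\<in>{1..k}. 1)"
      unfolding partial_sum_def using elim by (intro order_trans [OF sum_abs] sum_mono) auto
    then show ?case by simp
  qed
qed

lemma uniform_power_integrable:
  assumes "j \<ge> 1"
  shows "integrable M (\<lambda>\<omega>. U j \<omega> ^ m)"
proof (rule integrable_const_bound)
  show "AE \<omega> in M. norm (U j \<omega> ^ m) \<le> 1"
    using AE_uniform [OF assms] by eventually_elim (auto simp: power_le_one)
qed (use uniform_measurable [OF assms] in measurable)

lemma partial_sum_power_integrable: "integrable M (\<lambda>\<omega>. (x + partial_sum U k \<omega>) ^ m)"
proof (rule integrable_const_bound)
  show "AE \<omega> in M. norm ((x + partial_sum U k \<omega>) ^ m) \<le> (\<bar>x\<bar> + real k) ^ m"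
    using AE_partial_sum [of k]
    by eventually_elim (auto simp: norm_power power_abs intro!: power_mono)
qed (use partial_sum_measurable in measurable)

lemma expectation_uniform_power:
  assumes "j \<ge> 1"
  shows "expectation (\<lambda>\<omega>. U j \<omega> ^ m) = 1 / real (Suc m)"
proof -
  have "expectation (\<lambda>\<omega>. U j \<omega> ^ m) = (\<integral>y. y ^ m \<partial>distr M borel (U j))"
    using uniform_measurable [OF assms] by (subst integral_distr) auto
  then show ?thesis
    using iid assms by (simp add: iid_uniform_def integral_uniform_power)
qed

lemma expectation_partial_sum_Suc_expand:
  "expectation (\<lambda>\<omega>. (x + partial_sum U (Suc k) \<omega>) ^ m)
    = (\<Sum>j\<le>m. real (m choose j) * (expectation (\<lambda>\<omega>. (x + partial_sum U k \<omega>) ^ j) / real (Suc (m - j))))"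
proof -
  have "indep_vars (\<lambda>_. borel) U (insert (Suc k) {1..k})"
    using iid by (auto simp: iid_uniform_def intro: indep_vars_subset)
  then have indep: "indep_var borel (U (Suc k)) borel (partial_sum U k)"
    unfolding partial_sum_def [abs_def] by (intro indep_vars_sum) auto
  have prod: "expectation (\<lambda>\<omega>. U (Suc k) \<omega> ^ i * (x + partial_sum U k \<omega>) ^ j)
        = expectation (\<lambda>\<omega>. U (Suc k) \<omega> ^ i) * expectation (\<lambda>\<omega>. (x + partial_sum U k \<omega>) ^ j)"
    and int: "integrable M (\<lambda>\<omega>. U (Suc k) \<omega> ^ i * (x + partial_sum U k \<omega>) ^ j)" for i j
  proof -
    have "indep_var borel ((\<lambda>y. y ^ i) \<circ> U (Suc k)) borel ((\<lambda>y. (x + y) ^ j) \<circ> partial_sum U k)"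
      by (rule indep_var_compose [OF indep]) auto
    then have *: "indep_var borel (\<lambda>\<omega>. U (Suc k) \<omega> ^ i) borel (\<lambda>\<omega>. (x + partial_sum U k \<omega>) ^ j)"
      by (simp add: comp_def)
    show "expectation (\<lambda>\<omega>. U (Suc k) \<omega> ^ i * (x + partial_sum U k \<omega>) ^ j)
        = expectation (\<lambda>\<omega>. U (Suc k) \<omega> ^ i) * expectation (\<lambda>\<omega>. (x + partial_sum U k \<omega>) ^ j)"
      by (rule indep_var_lebesgue_integral [OF *])
         (auto intro: uniform_power_integrable partial_sum_power_integrable)
    show "integrable M (\<lambda>\<omega>. U (Suc k) \<omega> ^ i * (x + partial_sum U k \<omega>) ^ j)"
      by (rule indep_var_integrable [OF *])
         (auto intro: uniform_power_integrable partial_sum_power_integrable)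
  qed
  have "(x + partial_sum U (Suc k) \<omega>) ^ m
      = (\<Sum>j\<le>m. real (m choose j) * (U (Suc k) \<omega> ^ (m - j) * (x + partial_sum U k \<omega>) ^ j))" for \<omega>
  proof -
    have "x + partial_sum U (Suc k) \<omega> = (x + partial_sum U k \<omega>) + U (Suc k) \<omega>"
      by (simp add: partial_sum_def)
    then show ?thesis
      using binomial_ring [of "x + partial_sum U k \<omega>" "U (Suc k) \<omega>" m]
      by (simp only: mult_ac)
  qed
  then show ?thesis
    by (simp add: int prod expectation_uniform_power)
qed

text \<open>This is $(m+1) \int_0^1 (y+u)^m\,du = (y+1)^{m+1} - y^{m+1}$ averaged over
  $y = x + S_k$. It is checked coefficientwise in the moments of $x + S_k$, so independence
  enters through products of powers.\<close>

lemma expectation_partial_sum_Suc: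
  "real (Suc m) * expectation (\<lambda>\<omega>. (x + partial_sum U (Suc k) \<omega>) ^ m)
    = expectation (\<lambda>\<omega>. (x + 1 + partial_sum U k \<omega>) ^ Suc m)
      - expectation (\<lambda>\<omega>. (x + partial_sum U k \<omega>) ^ Suc m)"
proof -
  let ?E = "\<lambda>j. expectation (\<lambda>\<omega>. (x + partial_sum U k \<omega>) ^ j)"
  have "(x + 1 + partial_sum U k \<omega>) ^ Suc m
      = (\<Sum>j\<le>Suc m. real (Suc m choose j) * (x + partial_sum U k \<omega>) ^ j)" for \<omega>
    using binomial_ring [of "x + partial_sum U k \<omega>" 1 "Suc m"]
    by (simp only: power_one mult_1_right add_ac)
  then have "expectation (\<lambda>\<omega>. (x + 1 + partial_sum U k \<omega>) ^ Suc m)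
      = (\<Sum>j\<le>Suc m. expectation (\<lambda>\<omega>. real (Suc m choose j) * (x + partial_sum U k \<omega>) ^ j))"
    by (simp only:)
       (intro Bochner_Integration.integral_sum integrable_mult_right partial_sum_power_integrable)
  also have "\<dots> = (\<Sum>j\<le>Suc m. real (Suc m choose j) * ?E j)"
    by (simp only: integral_mult_right_zero)
  also have "\<dots> = (\<Sum>j\<le>m. real (Suc m choose j) * ?E j) + ?E (Suc m)"
    by simp
  also have "(\<Sum>j\<le>m. real (Suc m choose j) * ?E j)
      = (\<Sum>j\<le>m. real (Suc m) * (real (m choose j) * (?E j / real (Suc (m - j)))))"
  proof (intro sum.cong refl)
    fix j assume "j \<in> {..m}"
    then have "Suc (m - j) * (Suc m choose j) = Suc m * (m choose j)"
      using binomial_absorb_comp [of "Suc m" j] by (simp only: Suc_diff_le atMost_iff diff_Suc_1)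
    then have "real (Suc (m - j)) * real (Suc m choose j) = real (Suc m) * real (m choose j)"
      by (simp only: flip: of_nat_mult)
    then show "real (Suc m choose j) * ?E j
        = real (Suc m) * (real (m choose j) * (?E j / real (Suc (m - j))))"
      by (simp add: field_simps del: of_nat_Suc)
  qed
  finally show ?thesis
    unfolding expectation_partial_sum_Suc_expand by (simp add: sum_distrib_left)
qed

text \<open>Each further difference of the moment $E[(x+S_k)^{m+1}]$ in $x$ introduces one more
  uniform summand, lowers the exponent and releases the factor $m+1$; these factors accumulate to
  $n!/(n-k)! = k! \binom{n}{k}$.\<close>

lemma fdiff_power_eq_expectation:
  assumes "k \<le> n"
  shows "fdiff k (\<lambda>y. y ^ n) x
    = fact k * real (n choose k) * expectation (\<lambda>\<omega>. (x + partial_sum U k \<omega>) ^ (n - k))"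
  using assms
proof (induction k arbitrary: x)
  case 0
  show ?case by (simp add: partial_sum_def prob_space)
next
  case (Suc k)
  then obtain m where n: "n = Suc (m + k)"
    by (metis less_iff_Suc_add Suc_le_eq add.commute)
  let ?E = "\<lambda>k x m. expectation (\<lambda>\<omega>. (x + partial_sum U k \<omega>) ^ m)"
  have "fdiff (Suc k) (\<lambda>y. y ^ n) x = fact k * real (n choose k) * (?E k (x + 1) (Suc m) - ?E k x (Suc m))"
  proof -
    have "k \<le> n" and "n - k = Suc m" by (simp_all add: n)
    then show ?thesis by (simp only: fdiff_Suc Suc.IH right_diff_distrib)
  qed
  also have "\<dots> = fact k * (real (Suc m) * real (n choose k)) * ?E (Suc k) x m"
    by (simp only: expectation_partial_sum_Suc [symmetric] mult_ac)
  also have "real (Suc m) * real (n choose k) = real (Suc k) * real (n choose Suc k)"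
  proof -
    have "Suc m * (n choose k) = Suc k * (n choose Suc k)"
      using binomial_absorb_comp [of n k] binomial_absorption [of k n] by (simp add: n)
    then show ?thesis by (simp only: flip: of_nat_mult)
  qed
  finally show ?case by (simp add: n mult_ac)
qed

end

theorem theorem2:
  fixes A :: "nat \<Rightarrow> real poly"
  shows
    "(A \<in> appell_seqs \<longleftrightarrow>
        (\<exists>!a. a \<in> egf_seqs \<and> (\<lambda>n. poly (A n)) = fdiff_transform a monom_seq)) \<and>
     (\<forall>a :: nat \<Rightarrow> real.
        (\<forall>n. a n = (\<Sum>k\<le>n. signed_stirling n k * poly (A k) 0)) \<longleftrightarrow>
        (\<forall>n. poly (A n) 0 = (\<Sum>k\<le>n. real (Stirling n k) * a k))) \<and>
     (\<forall>a. a \<in> egf_seqs \<and> (\<lambda>n. poly (A n)) = fdiff_transform a monom_seq \<longrightarrow>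
        (\<forall>n. a n = (\<Sum>k\<le>n. signed_stirling n k * poly (A k) 0)) \<and>
        (\<forall>n. poly (A n) 0 = (\<Sum>k\<le>n. real (Stirling n k) * a k)) \<and>
        (\<forall>n x. poly (A n) x = (\<Sum>k\<le>n. a k / fact k * fdiff k (poly (monom_seq n)) x)) \<and>
        (\<forall>(M :: 'a measure) U. iid_uniform M U \<longrightarrow>
           (\<forall>n x. poly (A n) x =
              (\<Sum>k\<le>n. real (n choose k) * a k *
                 (\<integral>\<omega>. (x + partial_sum U k \<omega>) ^ (n - k) \<partial>M)))))"
proof (intro conjI allI impI)
  let ?b = "\<lambda>n. poly (A n) 0"
  have repr_iff: "(\<lambda>n. poly (A n)) = fdiff_transform a monom_seq \<longleftrightarrow>
      a = signed_stirling_transform ?b \<and>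
      (\<forall>n x. poly (A n) x = (\<Sum>k\<le>n. real (n choose k) * poly (A k) 0 * x ^ (n - k)))" for a
    by (simp only: eq_fdiff_transform_monom_seq_iff signed_stirling_transform_eq_iff)
  have mem_iff: "signed_stirling_transform ?b \<in> egf_seqs \<longleftrightarrow> ?b \<in> egf_seqs"
    using signed_stirling_transform_mem_egf_seqs Stirling_transform_mem_egf_seqs
      Stirling_transform_signed_stirling_transform by metis
  show "A \<in> appell_seqs \<longleftrightarrow>
      (\<exists>!a. a \<in> egf_seqs \<and> (\<lambda>n. poly (A n)) = fdiff_transform a monom_seq)"
    unfolding repr_iff appell_seqs_def mem_Collect_eq mem_iff [symmetric] by blast
  show "(\<forall>n. a n = (\<Sum>k\<le>n. signed_stirling n k * poly (A k) 0)) \<longleftrightarrow>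
      (\<forall>n. poly (A n) 0 = (\<Sum>k\<le>n. real (Stirling n k) * a k))" for a
    using signed_stirling_transform_eq_iff [of a ?b]
    by (simp add: fun_eq_iff Stirling_transform_def signed_stirling_transform_def)
  fix a
  assume "a \<in> egf_seqs \<and> (\<lambda>n. poly (A n)) = fdiff_transform a monom_seq"
  then have repr: "(\<lambda>n. poly (A n)) = fdiff_transform a monom_seq" ..
  then have a: "a = signed_stirling_transform ?b"
    unfolding repr_iff by (rule conjunct1)
  then have b: "?b = Stirling_transform a"
    by (simp only: signed_stirling_transform_eq_iff)
  show "a n = (\<Sum>k\<le>n. signed_stirling n k * poly (A k) 0)" for n
    using fun_cong [OF a, of n] by (simp add: signed_stirling_transform_def)
  show "poly (A n) 0 = (\<Sum>k\<le>n. real (Stirling n k) * a k)" for n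
    using fun_cong [OF b, of n] by (simp only: Stirling_transform_def)
  show A: "poly (A n) x = (\<Sum>k\<le>n. a k / fact k * fdiff k (poly (monom_seq n)) x)" for n x
    using fun_cong [OF fun_cong [OF repr, of n], of x] by (simp only: fdiff_transform_def)
  fix M :: "'a measure" and U n x
  assume iid: "iid_uniform M U"
  show "poly (A n) x =
      (\<Sum>k\<le>n. real (n choose k) * a k * (\<integral>\<omega>. (x + partial_sum U k \<omega>) ^ (n - k) \<partial>M))"
    unfolding A by (intro sum.cong refl)
      (simp add: poly_monom_seq fdiff_power_eq_expectation [OF iid])
qed

end
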